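(* Let $\mathbb{F}$ be a field of characteristic $0$, $E$ a vector space over $\mathbb{F}$, and let $\vec{\mathcal{X}}=(\mathcal{X}_1,\ldots,\mathcal{X}_n)$ and $\vec{Y}=(Y_1,\ldots,Y_n)$ be two $n$-tuples of linear operators on $E$, such that the $\mathcal{X}_\ell$ commute with each other and the $Y_k$ commute with each other. Let $\mathcal{K}=\sum_\ell\mathcal{X}_\ell\otimes e_{\eta_\ell}$ be the Koszul cohomology operator of $\vec{\mathcal{X}}$ and $\kappa=\sum_kY_k\otimes i_{h_k}$ the Koszul homology operator of $\vec{Y}$ on $E\otimes\bigwedge$. Then $$\mathcal{K}\kappa+\kappa\mathcal{K}=\Big(\sum_\ell Y_\ell\mathcal{X}_\ell\Big)\otimes\operatorname{id}+\sum_{k,\ell}[\mathcal{X}_\ell,Y_k]\otimes e_{\eta_\ell}i_{h_k}.$$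
   Context: $\bigwedge=\bigwedge_n\langle\vec\eta\rangle$ is the Grassmann algebra over $\mathbb{F}$ on generators $\eta_1,\ldots,\eta_n$; $h_1,\ldots,h_n$ are the dual generators, $i_{h_k}\eta_\ell=\delta_{k\ell}$; $e_{\eta_\ell}:\omega\mapsto\eta_\ell\,\omega$ is left multiplication and $i_{h_k}$ is the interior product (the antiderivation of $\bigwedge$ determined by $i_{h_k}\eta_\ell=\delta_{k\ell}$). *)

theory Defs
  imports Complex_Main "HOL-Library.Poly_Mapping" "HOL-Library.Function_Algebras"
begin

section \<open>The Grassmann algebra\<close>

text \<open>
  The generators \<open>\<eta>\<close> are indexed by a finite linearly ordered type \<open>'n\<close> (so \<open>n = CARD('n)\<close>), and an
  element of the algebra is the family of its coefficients with respect to the monomials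
  \<open>\<eta>\<^sub>I = \<eta>\<^sub>i\<^sub>1 \<cdots> \<eta>\<^sub>i\<^sub>p\<close>, where \<open>I = {i\<^sub>1 < \<cdots> < i\<^sub>p}\<close>.
\<close>

typedef ('f, 'n) grassmann = "UNIV :: ('n set \<Rightarrow> 'f) set"
  morphisms coeff Grassmann ..

lemma coeff_Grassmann [simp]: "coeff (Grassmann f) = f"
  by (simp add: Grassmann_inverse)

lemma grassmann_eqI: "(\<And>I. coeff a I = coeff b I) \<Longrightarrow> a = b"
  by (metis coeff_inverse ext)

definition inversions :: "'n::linorder set \<Rightarrow> 'n set \<Rightarrow> nat" where
  "inversions I J = card {(i, j). i \<in> I \<and> j \<in> J \<and> j < i}"

text \<open>For disjoint \<open>I\<close> and \<open>J\<close>, \<open>\<eta>\<^sub>I \<eta>\<^sub>J = (-1) ^ inversions I J \<cdot> \<eta>\<^sub>I\<^sub>\<union>\<^sub>J\<close>; otherwise \<open>\<eta>\<^sub>I \<eta>\<^sub>J = 0\<close>.\<close>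

instantiation grassmann :: (comm_ring_1, "{finite, linorder}") ring_1
begin

definition "0 = Grassmann (\<lambda>I. 0)"
definition "1 = Grassmann (\<lambda>I. if I = {} then 1 else 0)"
definition "a + b = Grassmann (\<lambda>I. coeff a I + coeff b I)"
definition "- a = Grassmann (\<lambda>I. - coeff a I)"
definition "a - b = Grassmann (\<lambda>I. coeff a I - coeff b I)"
definition "a * b = Grassmann (\<lambda>K. \<Sum>I\<in>Pow K.
  (-1) ^ inversions I (K - I) * coeff a I * coeff b (K - I))" for a b :: "('a, 'b) grassmann"

lemma coeff_simps [simp]:
  "coeff 0 I = 0"
  "coeff 1 I = (if I = {} then 1 else 0)"
  "coeff (a + b) I = coeff a I + coeff b I"
  "coeff (- a) I = - coeff a I"
  "coeff (a - b) I = coeff a I - coeff b I"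
  by (simp_all add: zero_grassmann_def one_grassmann_def plus_grassmann_def
      uminus_grassmann_def minus_grassmann_def)

lemma coeff_mult:
  "coeff (a * b) K = (\<Sum>I\<in>Pow K. (-1) ^ inversions I (K - I) * coeff a I * coeff b (K - I))"
  by (simp add: times_grassmann_def)

lemma inversions_empty [simp]: "inversions {} J = 0" "inversions I {} = 0"
  by (simp_all add: inversions_def)

lemma inversions_Un_left:
  fixes A B C :: "'n::{finite, linorder} set"
  assumes "A \<inter> B = {}"
  shows "inversions (A \<union> B) C = inversions A C + inversions B C"
proof -
  have "{(i, j). i \<in> A \<union> B \<and> j \<in> C \<and> j < i} =
      {(i, j). i \<in> A \<and> j \<in> C \<and> j < i} \<union> {(i, j). i \<in> B \<and> j \<in> C \<and> j < i}"
    by auto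
  then show ?thesis
    unfolding inversions_def using assms by (simp, subst card_Un_disjoint) auto
qed

lemma inversions_Un_right:
  fixes A B C :: "'n::{finite, linorder} set"
  assumes "A \<inter> B = {}"
  shows "inversions C (A \<union> B) = inversions C A + inversions C B"
proof -
  have "{(i, j). i \<in> C \<and> j \<in> A \<union> B \<and> j < i} =
      {(i, j). i \<in> C \<and> j \<in> A \<and> j < i} \<union> {(i, j). i \<in> C \<and> j \<in> B \<and> j < i}"
    by auto
  then show ?thesis
    unfolding inversions_def using assms by (simp, subst card_Un_disjoint) auto
qed

instance
proof
  fix a b c :: "('a, 'b) grassmann"
  show "a + b + c = a + (b + c)" "a + b = b + a" "0 + a = a" "- a + a = 0" "a - b = a + - b"
    by (auto intro: grassmann_eqI)
  show "(a + b) * c = a * c + b * c" "a * (b + c) = a * b + a * c"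
    by (auto intro!: grassmann_eqI simp: coeff_mult algebra_simps sum.distrib)
  have "coeff (1 * a) K = coeff a K" for K
  proof -
    have "coeff (1 * a) K = (\<Sum>I\<in>Pow K. if I = {} then coeff a K else 0)"
      unfolding coeff_mult by (rule sum.cong) auto
    then show ?thesis by simp
  qed
  then show "1 * a = a" by (rule grassmann_eqI)
  have "coeff (a * 1) K = coeff a K" for K
  proof -
    have "coeff (a * 1) K = (\<Sum>I\<in>Pow K. if I = K then coeff a K else 0)"
      unfolding coeff_mult by (rule sum.cong) auto
    then show ?thesis by simp
  qed
  then show "a * 1 = a" by (rule grassmann_eqI)
  have "coeff 0 {} \<noteq> coeff (1 :: ('a, 'b) grassmann) {}"
    by simp
  then show "(0 :: ('a, 'b) grassmann) \<noteq> 1"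
    by metis
  have "coeff (a * b * c) K = coeff (a * (b * c)) K" for K
  proof -
    let ?t = "\<lambda>A B C. (-1) ^ (inversions A B + inversions A C + inversions B C) *
      coeff a A * coeff b B * coeff c C"
    have "coeff (a * b * c) K = (\<Sum>I\<in>Pow K. \<Sum>A\<in>Pow I. ?t A (I - A) (K - I))"
      unfolding coeff_mult sum_distrib_left sum_distrib_right
    proof (intro sum.cong refl)
      fix I A assume "I \<in> Pow K" "A \<in> Pow I"
      then have "inversions I (K - I) = inversions A (K - I) + inversions (I - A) (K - I)"
        using inversions_Un_left[of A "I - A" "K - I"] by (simp add: Un_absorb1)
      then show "(-1) ^ inversions I (K - I) * ((-1) ^ inversions A (I - A) * coeff a A *
          coeff b (I - A)) * coeff c (K - I) = ?t A (I - A) (K - I)"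
        by (simp add: power_add algebra_simps)
    qed
    also have "\<dots> = (\<Sum>(I, A)\<in>Sigma (Pow K) Pow. ?t A (I - A) (K - I))"
      by (rule sum.Sigma) auto
    also have "\<dots> = (\<Sum>(A, B)\<in>Sigma (Pow K) (\<lambda>A. Pow (K - A)). ?t A B (K - A - B))"
      by (rule sum.reindex_bij_witness[where i = "\<lambda>(A, B). (A \<union> B, A)" and j = "\<lambda>(I, A). (A, I - A)"])
        (auto simp: Diff_Diff_Int Un_absorb1 Diff_eq intro!: arg_cong[where f = "?t _ _"])
    also have "\<dots> = (\<Sum>A\<in>Pow K. \<Sum>B\<in>Pow (K - A). ?t A B (K - A - B))"
      by (rule sum.Sigma[symmetric]) auto
    also have "\<dots> = coeff (a * (b * c)) K"
      unfolding coeff_mult sum_distrib_left sum_distrib_right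
    proof (intro sum.cong refl)
      fix A B assume "A \<in> Pow K" "B \<in> Pow (K - A)"
      then have "inversions A (K - A) = inversions A B + inversions A (K - A - B)"
        using inversions_Un_right[of B "K - A - B" A] by (simp add: Un_absorb1)
      then show "?t A B (K - A - B) = (-1) ^ inversions A (K - A) * coeff a A *
          ((-1) ^ inversions B (K - A - B) * coeff b B * coeff c (K - A - B))"
        by (simp add: power_add algebra_simps)
    qed
    finally show ?thesis .
  qed
  then show "a * b * c = a * (b * c)" by (rule grassmann_eqI)
qed

end

definition gscale :: "'f::comm_ring_1 \<Rightarrow> ('f, 'n::{finite, linorder}) grassmann \<Rightarrow> ('f, 'n) grassmann" where
  "gscale c a = Grassmann (\<lambda>I. c * coeff a I)"

definition monomial :: "'n::{finite, linorder} set \<Rightarrow> ('f::comm_ring_1, 'n) grassmann" where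
  "monomial I = Grassmann (\<lambda>J. if J = I then 1 else 0)"

definition gen :: "'n::{finite, linorder} \<Rightarrow> ('f::comm_ring_1, 'n) grassmann" (\<open>\<eta>\<close>) where
  "\<eta> l = monomial {l}"

lemma coeff_gscale [simp]: "coeff (gscale c a) I = c * coeff a I"
  by (simp add: gscale_def)

lemma coeff_monomial [simp]: "coeff (monomial I) J = (if J = I then 1 else 0)"
  by (simp add: monomial_def)

lemma coeff_gen [simp]: "coeff (\<eta> l) J = (if J = {l} then 1 else 0)"
  by (simp add: gen_def)

lemma vector_space_gscale: "vector_space gscale"
  by unfold_locales (auto intro!: grassmann_eqI simp: algebra_simps)

lemma gscale_mult:
  "gscale c a * b = gscale c (a * b)" "a * gscale c b = gscale c (a * b)"
  by (auto intro!: grassmann_eqI simp: coeff_mult sum_distrib_left algebra_simps)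

lemma coeff_sum: "coeff (sum f S) I = (\<Sum>s\<in>S. coeff (f s) I)"
  by (induction S rule: infinite_finite_induct) auto

lemma grassmann_expand: "a = (\<Sum>I\<in>UNIV. gscale (coeff a I) (monomial I))"
proof (rule grassmann_eqI)
  fix J
  have "(\<Sum>I\<in>UNIV. coeff a I * (if J = I then 1 else 0)) = (\<Sum>I\<in>UNIV. if J = I then coeff a I else 0)"
    by (rule sum.cong) auto
  then show "coeff a J = coeff (\<Sum>I\<in>UNIV. gscale (coeff a I) (monomial I)) J"
    by (simp add: coeff_sum)
qed

lemma coeff_gen_mult:
  "coeff (\<eta> l * a) K = (if l \<in> K then (-1) ^ inversions {l} (K - {l}) * coeff a (K - {l}) else 0)"
proof -
  have "coeff (\<eta> l * a) K = (\<Sum>I\<in>Pow K. if I = {l} then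
      (-1) ^ inversions {l} (K - {l}) * coeff a (K - {l}) else 0)"
    unfolding coeff_mult by (rule sum.cong) auto
  then show ?thesis by simp
qed

lemma monomial_empty: "monomial {} = 1"
  by (rule grassmann_eqI) simp

lemma monomial_insert:
  assumes "\<forall>i\<in>I. l < i"
  shows "monomial (insert l I) = \<eta> l * monomial I"
proof (rule grassmann_eqI)
  fix K
  have l: "l \<notin> I" using assms by auto
  have "inversions {l} I = 0"
    using assms by (auto simp: inversions_def)
  then show "coeff (monomial (insert l I)) K = coeff (\<eta> l * monomial I) K"
    using l by (auto simp: coeff_gen_mult)
qed

lemma gen_anticommute:
  fixes k l :: "'n::{finite, linorder}"
  shows "\<eta> k * \<eta> l = - (\<eta> l * \<eta> k)"
proof (rule grassmann_eqI)
  fix K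
  have *: "inversions {i} {j} = (if j < i then 1 else 0)" for i j :: 'n
  proof -
    have "{(i', j'). i' \<in> {i} \<and> j' \<in> {j} \<and> j' < i'} = (if j < i then {(i, j)} else {})"
      by auto
    then show ?thesis by (simp add: inversions_def)
  qed
  show "coeff (\<eta> k * \<eta> l) K = coeff (- (\<eta> l * \<eta> k)) K"
  proof (cases "k \<noteq> l \<and> K = {k, l}")
    case True
    then have "K - {k} = {l}" "K - {l} = {k}" by auto
    with True show ?thesis by (cases k l rule: linorder_cases) (auto simp: coeff_gen_mult *)
  next
    case False
    then have "k \<in> K \<Longrightarrow> K - {k} \<noteq> {l}" "l \<in> K \<Longrightarrow> K - {l} \<noteq> {k}" by auto
    then show ?thesis by (auto simp: coeff_gen_mult)
  qed
qed

lemma gen_square: "\<eta> k * \<eta> k = 0"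
  by (rule grassmann_eqI) (auto simp: coeff_gen_mult)


section \<open>Exterior and interior multiplication\<close>

definition homogeneous :: "nat \<Rightarrow> ('f::comm_ring_1, 'n::{finite, linorder}) grassmann \<Rightarrow> bool" where
  "homogeneous p a \<longleftrightarrow> (\<forall>I. coeff a I \<noteq> 0 \<longrightarrow> card I = p)"

definition antiderivation ::
    "(('f::field, 'n::{finite, linorder}) grassmann \<Rightarrow> ('f, 'n) grassmann) \<Rightarrow> bool" where
  "antiderivation D \<longleftrightarrow> Vector_Spaces.linear gscale gscale D \<and>
    (\<forall>p a b. homogeneous p a \<longrightarrow> D (a * b) = D a * b + (-1) ^ p * (a * D b))"

definition ext_mult :: "'n \<Rightarrow> ('f::field, 'n::{finite, linorder}) grassmann \<Rightarrow> ('f, 'n) grassmann" where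
  "ext_mult l a = \<eta> l * a"

definition int_mult :: "'n \<Rightarrow> ('f::field, 'n::{finite, linorder}) grassmann \<Rightarrow> ('f, 'n) grassmann" where
  "int_mult k = (THE D. antiderivation D \<and> (\<forall>l. D (\<eta> l) = (if k = l then 1 else 0)))"

lemma homogeneous_monomial: "homogeneous (card I) (monomial I)"
  by (auto simp: homogeneous_def)

lemma antiderivation_unique:
  fixes D D' :: "('f::field, 'n::{finite, linorder}) grassmann \<Rightarrow> ('f, 'n) grassmann"
  assumes D: "antiderivation D" and D': "antiderivation D'"
    and gens: "\<And>l. D (\<eta> l) = D' (\<eta> l)"
  shows "D = D'"
proof -
  interpret D: Vector_Spaces.linear gscale gscale D using D by (simp add: antiderivation_def)
  interpret D': Vector_Spaces.linear gscale gscale D' using D' by (simp add: antiderivation_def)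
  have leib: "E (a * b) = E a * b + (-1) ^ p * (a * E b)"
    if "antiderivation E" "homogeneous p a" for E p and a b :: "('f, 'n) grassmann"
    using that by (auto simp: antiderivation_def)
  have one: "E 1 = 0" if "antiderivation E" for E :: "('f, 'n) grassmann \<Rightarrow> ('f, 'n) grassmann"
    using leib[OF that, of 0 1 1] homogeneous_monomial[of "{}"] by (auto simp: monomial_empty)
  have mono: "D (monomial I) = D' (monomial I)" for I
    using finite[of I]
  proof (induction I rule: finite_linorder_min_induct)
    case empty
    show ?case by (simp add: monomial_empty one D D')
  next
    case (insert l I)
    have "homogeneous 1 (\<eta> l :: ('f, 'n) grassmann)"
      using homogeneous_monomial[of "{l}"] by (simp add: gen_def)
    then show ?case
      using insert by (simp add: monomial_insert leib[OF D] leib[OF D'] gens)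
  qed
  show "D = D'"
  proof
    fix a
    have "D a = (\<Sum>I\<in>UNIV. gscale (coeff a I) (D (monomial I)))"
      by (subst grassmann_expand[of a]) (simp add: D.sum D.scale)
    moreover have "D' a = (\<Sum>I\<in>UNIV. gscale (coeff a I) (D' (monomial I)))"
      by (subst grassmann_expand[of a]) (simp add: D'.sum D'.scale)
    ultimately show "D a = D' a" by (simp add: mono)
  qed
qed

definition contraction :: "'n \<Rightarrow> ('f::field, 'n::{finite, linorder}) grassmann \<Rightarrow> ('f, 'n) grassmann" where
  "contraction k a = Grassmann (\<lambda>I. if k \<in> I then 0
     else (-1) ^ inversions {k} I * coeff a (insert k I))"

lemma inversions_insert_left:
  fixes I J :: "'n::{finite, linorder} set"
  shows "k \<notin> I \<Longrightarrow> inversions (insert k I) J = inversions {k} J + inversions I J"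
  using inversions_Un_left[of "{k}" I J] by simp

lemma inversions_insert_right:
  fixes I J :: "'n::{finite, linorder} set"
  shows "k \<notin> I \<Longrightarrow> inversions J (insert k I) = inversions J {k} + inversions J I"
  using inversions_Un_right[of "{k}" I J] by simp

lemma inversions_swap:
  fixes I :: "'n::{finite, linorder} set"
  assumes "k \<notin> I"
  shows "inversions I {k} + inversions {k} I = card I"
proof -
  have 1: "{(i, j). i \<in> I \<and> j \<in> {k} \<and> j < i} = (\<lambda>i. (i, k)) ` {i \<in> I. k < i}" by auto
  have 2: "{(i, j). i \<in> {k} \<and> j \<in> I \<and> j < i} = Pair k ` {i \<in> I. i < k}" by auto
  have "inversions I {k} + inversions {k} I = card {i \<in> I. k < i} + card {i \<in> I. i < k}"
    unfolding inversions_def 1 2 by (simp add: card_image inj_on_def)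
  also have "\<dots> = card ({i \<in> I. k < i} \<union> {i \<in> I. i < k})"
    by (rule card_Un_disjoint[symmetric]) auto
  also have "{i \<in> I. k < i} \<union> {i \<in> I. i < k} = I"
    using assms by auto (metis linorder_neqE)
  finally show ?thesis .
qed

lemma coeff_minus_one_power: "coeff ((-1) ^ p * a) I = (-1) ^ p * coeff a I"
  by (induction p) (auto simp: mult.assoc)

lemma sum_Pow_insert:
  fixes K :: "'n::finite set" and g :: "'n set \<Rightarrow> 'b::comm_monoid_add"
  assumes "k \<notin> K"
  shows "sum g (Pow (insert k K)) = (\<Sum>I\<in>Pow K. g (insert k I) + g I)"
proof -
  have "inj_on (insert k) (Pow K)"
    using assms by (intro inj_onI) (metis PowD insert_ident subsetD)
  moreover have "Pow K \<inter> insert k ` Pow K = {}"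
    using assms by auto
  ultimately show ?thesis
    by (simp add: Pow_insert sum.union_disjoint sum.reindex sum.distrib add.commute)
qed

lemma antiderivation_contraction:
  fixes k :: "'n::{finite, linorder}"
  shows "antiderivation (contraction k :: ('f::field, 'n) grassmann \<Rightarrow> _)"
  unfolding antiderivation_def
proof (intro conjI allI impI)
  show "Vector_Spaces.linear gscale gscale (contraction k :: ('f, 'n) grassmann \<Rightarrow> _)"
    unfolding Vector_Spaces.linear_iff
    by (auto intro!: grassmann_eqI vector_space_gscale simp: contraction_def algebra_simps)
  fix p and a b :: "('f, 'n) grassmann"
  assume hom: "homogeneous p a"
  show "contraction k (a * b) = contraction k a * b + (-1) ^ p * (a * contraction k b)"
  proof (rule grassmann_eqI)
    fix K
    let ?s = "\<lambda>I J. (-1 :: 'f) ^ inversions I J"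
    let ?L = "\<lambda>I. ?s I (insert k K - I) * coeff a I * coeff b (insert k K - I)"
    show "coeff (contraction k (a * b)) K =
      coeff (contraction k a * b + (-1) ^ p * (a * contraction k b)) K"
    proof (cases "k \<in> K")
      case True
      have "(\<Sum>I\<in>Pow K. ?s I (K - I) * coeff (contraction k a) I * coeff b (K - I)) +
          (-1) ^ p * (\<Sum>I\<in>Pow K. ?s I (K - I) * coeff a I * coeff (contraction k b) (K - I)) =
          (\<Sum>I\<in>Pow K. ?s I (K - I) * coeff (contraction k a) I * coeff b (K - I) +
          (-1) ^ p * (?s I (K - I) * coeff a I * coeff (contraction k b) (K - I)))"
        by (simp add: sum.distrib sum_distrib_left)
      also have "\<dots> = (\<Sum>I\<in>Pow (K - {k}). ?s (insert k I) (K - insert k I) *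
            coeff (contraction k a) (insert k I) * coeff b (K - insert k I) +
          (-1) ^ p * (?s (insert k I) (K - insert k I) * coeff a (insert k I) *
            coeff (contraction k b) (K - insert k I)) + (?s I (K - I) * coeff (contraction k a) I *
            coeff b (K - I) +
          (-1) ^ p * (?s I (K - I) * coeff a I * coeff (contraction k b) (K - I))))"
        using sum_Pow_insert[of k "K - {k}" "\<lambda>I. ?s I (K - I) * coeff (contraction k a) I * coeff b (K - I) +
          (-1) ^ p * (?s I (K - I) * coeff a I * coeff (contraction k b) (K - I))"] True
        by (simp add: insert_absorb)
      also have "\<dots> = 0"
      proof (rule sum.neutral, rule ballI)
        fix I assume I: "I \<in> Pow (K - {k})"
        define J where "J = K - insert k I"
        have J: "k \<notin> J" "K - I = insert k J" "K - insert k I = J" "k \<notin> I"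
          using I True by (auto simp: J_def)
        have sgn: "inversions I {k} + inversions {k} I = card I"
          using J by (intro inversions_swap)
        show "?s (insert k I) (K - insert k I) *
            coeff (contraction k a) (insert k I) * coeff b (K - insert k I) +
          (-1) ^ p * (?s (insert k I) (K - insert k I) * coeff a (insert k I) *
            coeff (contraction k b) (K - insert k I)) + (?s I (K - I) * coeff (contraction k a) I *
            coeff b (K - I) +
          (-1) ^ p * (?s I (K - I) * coeff a I * coeff (contraction k b) (K - I))) = 0"
        proof (cases "coeff a (insert k I) = 0")
          case True
          then show ?thesis using J by (simp add: contraction_def)
        next
          case False
          then have "p = Suc (card I)"
            using hom J by (auto simp: homogeneous_def)
          then show ?thesis
            using J by (simp add: contraction_def inversions_insert_left[of k I J]
                inversions_insert_right[of k J I] power_add sgn[symmetric])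
        qed
      qed
      finally show ?thesis
        using True unfolding coeff_simps coeff_minus_one_power
        by (simp add: contraction_def coeff_mult)
    next
      case False
      have "coeff (contraction k (a * b)) K = ?s {k} K * (\<Sum>I\<in>Pow (insert k K). ?L I)"
        using False by (simp add: contraction_def coeff_mult)
      also have "(\<Sum>I\<in>Pow (insert k K). ?L I) = (\<Sum>I\<in>Pow K. ?L I) + (\<Sum>I\<in>Pow K. ?L (insert k I))"
        using sum_Pow_insert[OF False, of ?L] by (simp add: sum.distrib)
      also have "?s {k} K * \<dots> = (\<Sum>I\<in>Pow K. ?s {k} K * ?L (insert k I)) + (\<Sum>I\<in>Pow K. ?s {k} K * ?L I)"
        by (simp add: sum_distrib_left algebra_simps)
      also have "(\<Sum>I\<in>Pow K. ?s {k} K * ?L (insert k I)) = coeff (contraction k a * b) K"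
        unfolding coeff_mult
      proof (intro sum.cong refl)
        fix I assume I: "I \<in> Pow K"
        define J where "J = K - I"
        have J: "k \<notin> J" "insert k K - insert k I = J" "K - I = J" "k \<notin> I" "K = I \<union> J" "I \<inter> J = {}"
          using I False by (auto simp: J_def)
        show "?s {k} K * ?L (insert k I) =
            ?s I (K - I) * coeff (contraction k a) I * coeff b (K - I)"
          unfolding J(2,3) using J(1,4,6)
          by (simp add: J(5) contraction_def inversions_insert_left[of k I J] inversions_Un_right power_add)
      qed
      also have "(\<Sum>I\<in>Pow K. ?s {k} K * ?L I) = coeff ((-1) ^ p * (a * contraction k b)) K"
        unfolding coeff_minus_one_power unfolding coeff_mult sum_distrib_left
      proof (intro sum.cong refl)
        fix I assume I: "I \<in> Pow K"
        define J where "J = K - I"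
        have J: "k \<notin> J" "insert k K - I = insert k J" "K - I = J" "k \<notin> I" "K = I \<union> J" "I \<inter> J = {}"
          using I False by (auto simp: J_def)
        show "?s {k} K * ?L I =
            (-1) ^ p * (?s I (K - I) * coeff a I * coeff (contraction k b) (K - I))"
        proof (cases "coeff a I = 0")
          case False
          then have "p = inversions I {k} + inversions {k} I"
            using hom J by (auto simp: homogeneous_def inversions_swap)
          then show ?thesis
            unfolding J(2,3) using J(1,4,6)
            by (simp add: J(5) contraction_def inversions_insert_right[of k J I] inversions_Un_right power_add)
        qed simp
      qed
      finally show ?thesis by simp
    qed
  qed
qed

lemma contraction_gen: "contraction k (\<eta> l) = (if k = l then 1 else 0)"
proof (rule grassmann_eqI)
  fix I :: "'b set"
  have "k \<notin> I \<Longrightarrow> insert k I = {l} \<longleftrightarrow> I = {} \<and> k = l" by auto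
  then show "coeff (contraction k (\<eta> l)) I = coeff (if k = l then 1 else 0) I"
    by (auto simp: contraction_def)
qed

lemma int_mult_ex1: "\<exists>!D. antiderivation D \<and> (\<forall>l. D (\<eta> l) = (if k = l then 1 else 0))"
  by (rule ex1I[of _ "contraction k"])
    (auto simp: contraction_gen antiderivation_contraction intro!: antiderivation_unique)

lemma int_mult_eq_contraction: "int_mult k = contraction k"
  unfolding int_mult_def
  by (rule the1_equality[OF int_mult_ex1]) (simp add: contraction_gen antiderivation_contraction)


section \<open>Tensor products of vector spaces\<close>

text \<open>
  \<open>tensor_product sE sF sT tens\<close> says that the vector space \<open>'t\<close>, together with \<open>tens\<close>, is
  \<open>E \<otimes> F\<close>: the linear map from the free vector space on \<open>E \<times> F\<close> to \<open>'t\<close> that extends \<open>tens\<close> is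
  onto, and its kernel is spanned by the bilinearity relators.
\<close>

definition free_scale :: "'f::field \<Rightarrow> ('a \<Rightarrow>\<^sub>0 'f) \<Rightarrow> ('a \<Rightarrow>\<^sub>0 'f)" where
  "free_scale c z = Poly_Mapping.map ((*) c) z"

definition free_extend :: "('f::field \<Rightarrow> 't::ab_group_add \<Rightarrow> 't) \<Rightarrow> ('a \<Rightarrow> 't) \<Rightarrow> ('a \<Rightarrow>\<^sub>0 'f) \<Rightarrow> 't" where
  "free_extend sT g z = (\<Sum>p\<in>Poly_Mapping.keys z. sT (Poly_Mapping.lookup z p) (g p))"

abbreviation free_gen :: "'a \<Rightarrow> ('a \<Rightarrow>\<^sub>0 'f::field)" where
  "free_gen p \<equiv> Poly_Mapping.single p 1"

definition bilinear_relators ::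
    "('f::field \<Rightarrow> 'e::ab_group_add \<Rightarrow> 'e) \<Rightarrow> ('f \<Rightarrow> 'b::ab_group_add \<Rightarrow> 'b) \<Rightarrow> ('e \<times> 'b \<Rightarrow>\<^sub>0 'f) set" where
  "bilinear_relators sE sF =
     {free_gen (x + y, w) - free_gen (x, w) - free_gen (y, w) | x y w. True} \<union>
     {free_gen (x, v + w) - free_gen (x, v) - free_gen (x, w) | x v w. True} \<union>
     {free_gen (sE c x, w) - free_scale c (free_gen (x, w)) | c x w. True} \<union>
     {free_gen (x, sF c w) - free_scale c (free_gen (x, w)) | c x w. True}"

locale tensor_product =
  E: vector_space sE + F: vector_space sF + T: vector_space sT
  for sE :: "'f::field \<Rightarrow> 'e::ab_group_add \<Rightarrow> 'e"
    and sF :: "'f \<Rightarrow> 'b::ab_group_add \<Rightarrow> 'b"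
    and sT :: "'f \<Rightarrow> 't::ab_group_add \<Rightarrow> 't" +
  fixes tens :: "'e \<Rightarrow> 'b \<Rightarrow> 't"
  assumes onto: "surj (free_extend sT (\<lambda>(x, w). tens x w))"
    and kernel: "{z. free_extend sT (\<lambda>(x, w). tens x w) z = 0} =
      module.span free_scale (bilinear_relators sE sF)"

definition tensor_map :: "('f::field \<Rightarrow> 't::ab_group_add \<Rightarrow> 't) \<Rightarrow> ('e \<Rightarrow> 'b \<Rightarrow> 't) \<Rightarrow>
    ('e \<Rightarrow> 'e) \<Rightarrow> ('b \<Rightarrow> 'b) \<Rightarrow> 't \<Rightarrow> 't" where
  "tensor_map sT tens A B =
     (THE h. Vector_Spaces.linear sT sT h \<and> (\<forall>x w. h (tens x w) = tens (A x) (B w)))"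

lemma lookup_free_scale [simp]: "Poly_Mapping.lookup (free_scale c z) p = c * Poly_Mapping.lookup z p"
  by (simp add: free_scale_def Poly_Mapping.map.rep_eq when_def)

lemma vector_space_free_scale: "vector_space free_scale"
  by unfold_locales (auto intro!: poly_mapping_eqI simp: lookup_add algebra_simps)

lemma free_extend_superset:
  assumes "vector_space sT" "finite S" "Poly_Mapping.keys z \<subseteq> S"
  shows "free_extend sT g z = (\<Sum>p\<in>S. sT (Poly_Mapping.lookup z p) (g p))"
proof -
  interpret vector_space sT by fact
  show ?thesis
    unfolding free_extend_def using assms(2,3)
    by (intro sum.mono_neutral_left) (auto simp: in_keys_iff)
qed

lemma linear_free_extend:
  fixes sT :: "'f::field \<Rightarrow> 't::ab_group_add \<Rightarrow> 't" and g :: "'a \<Rightarrow> 't"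
  assumes "vector_space sT"
  shows "Vector_Spaces.linear free_scale sT (free_extend sT g)"
proof -
  interpret vector_space sT by fact
  show ?thesis
    unfolding Vector_Spaces.linear_iff
  proof (intro conjI allI vector_space_free_scale assms)
    fix z z' :: "'a \<Rightarrow>\<^sub>0 'f" and c
    let ?S = "Poly_Mapping.keys z \<union> Poly_Mapping.keys z'"
    show "free_extend sT g (z + z') = free_extend sT g z + free_extend sT g z'"
      using Poly_Mapping.keys_add[of z z']
      by (simp add: free_extend_superset[OF assms, of ?S] lookup_add scale_left_distrib sum.distrib)
    have "Poly_Mapping.keys (free_scale c z) \<subseteq> Poly_Mapping.keys z"
      by (auto simp: in_keys_iff)
    then show "free_extend sT g (free_scale c z) = sT c (free_extend sT g z)"
      by (simp add: free_extend_superset[OF assms, of "Poly_Mapping.keys z"] scale_sum_right)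
  qed
qed

lemma free_extend_gen [simp]:
  assumes "vector_space sT"
  shows "free_extend sT g (free_gen p) = g p"
proof -
  interpret vector_space sT by fact
  show ?thesis by (simp add: free_extend_def)
qed

lemma free_expand:
  fixes z :: "'a \<Rightarrow>\<^sub>0 'f::field"
  shows "z = (\<Sum>p\<in>Poly_Mapping.keys z. free_scale (Poly_Mapping.lookup z p) (free_gen p))"
proof (rule poly_mapping_eqI)
  fix q
  have "(\<Sum>p\<in>Poly_Mapping.keys z. Poly_Mapping.lookup z p * Poly_Mapping.lookup (free_gen p) q) =
      (\<Sum>p\<in>Poly_Mapping.keys z. if p = q then Poly_Mapping.lookup z q else 0)"
    by (rule sum.cong) (auto simp: lookup_single when_def)
  then show "Poly_Mapping.lookup z q = Poly_Mapping.lookup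
      (\<Sum>p\<in>Poly_Mapping.keys z. free_scale (Poly_Mapping.lookup z p) (free_gen p)) q"
    by (simp add: lookup_sum in_keys_iff)
qed

lemma linear_free_ext:
  assumes "Vector_Spaces.linear free_scale sT f" "Vector_Spaces.linear free_scale sT g"
    and "\<And>p. f (free_gen p) = g (free_gen p)"
  shows "f = g"
proof
  fix z
  interpret f: Vector_Spaces.linear free_scale sT f by fact
  interpret g: Vector_Spaces.linear free_scale sT g by fact
  show "f z = g z"
    by (subst (1 2) free_expand[of z]) (simp add: f.sum g.sum f.scale g.scale assms(3))
qed

context tensor_product
begin

abbreviation "ext \<equiv> free_extend sT (\<lambda>(x, w). tens x w)"

sublocale free: vector_space free_scale
  by (rule vector_space_free_scale)

sublocale ext: Vector_Spaces.linear free_scale sT ext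
  by (rule linear_free_extend) unfold_locales

lemma ext_gen: "ext (free_gen (x, w)) = tens x w"
  by (simp add: T.vector_space_axioms)

lemma relator_zero: "r \<in> bilinear_relators sE sF \<Longrightarrow> ext r = 0"
  using kernel free.span_base by blast

lemma tens_bilinear:
  "tens (x + y) w = tens x w + tens y w"
  "tens x (v + w) = tens x v + tens x w"
  "tens (sE c x) w = sT c (tens x w)"
  "tens x (sF c w) = sT c (tens x w)"
proof -
  have "free_gen (x + y, w) - free_gen (x, w) - free_gen (y, w) \<in> bilinear_relators sE sF"
    unfolding bilinear_relators_def by blast
  from relator_zero[OF this] show "tens (x + y) w = tens x w + tens y w"
    unfolding ext.diff ext_gen by (simp add: algebra_simps)
  have "free_gen (x, v + w) - free_gen (x, v) - free_gen (x, w) \<in> bilinear_relators sE sF"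
    unfolding bilinear_relators_def by blast
  from relator_zero[OF this] show "tens x (v + w) = tens x v + tens x w"
    unfolding ext.diff ext_gen by (simp add: algebra_simps)
  have "free_gen (sE c x, w) - free_scale c (free_gen (x, w)) \<in> bilinear_relators sE sF"
    unfolding bilinear_relators_def by blast
  from relator_zero[OF this] show "tens (sE c x) w = sT c (tens x w)"
    by (simp add: ext.diff ext.scale ext_gen)
  have "free_gen (x, sF c w) - free_scale c (free_gen (x, w)) \<in> bilinear_relators sE sF"
    unfolding bilinear_relators_def by blast
  from relator_zero[OF this] show "tens x (sF c w) = sT c (tens x w)"
    by (simp add: ext.diff ext.scale ext_gen)
qed

lemma linear_tens_ext:
  assumes f: "Vector_Spaces.linear sT sU f" and g: "Vector_Spaces.linear sT sU g"
    and eq: "\<And>x w. f (tens x w) = g (tens x w)"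
  shows "f = g"
proof
  fix t
  interpret f: Vector_Spaces.linear sT sU f by fact
  interpret g: Vector_Spaces.linear sT sU g by fact
  obtain z where z: "t = ext z" using onto by blast
  show "f t = g t"
    unfolding z free_extend_def
    by (simp add: f.sum g.sum f.scale g.scale eq case_prod_beta)
qed

lemma bilinear_extend_ex1:
  assumes U: "vector_space sU"
    and b: "\<And>x y w. b (x + y) w = b x w + b y w" "\<And>x v w. b x (v + w) = b x v + b x w"
      "\<And>c x w. b (sE c x) w = sU c (b x w)" "\<And>c x w. b x (sF c w) = sU c (b x w)"
  shows "\<exists>!h. Vector_Spaces.linear sT sU h \<and> (\<forall>x w. h (tens x w) = b x w)"
proof (rule ex_ex1I)
  interpret U: vector_space sU by fact
  let ?B = "free_extend sU (\<lambda>(x, w). b x w)"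
  interpret B: Vector_Spaces.linear free_scale sU ?B
    by (rule linear_free_extend) fact
  have B_gen: "?B (free_gen (x, w)) = b x w" for x w
    by (simp add: U)
  have "bilinear_relators sE sF \<subseteq> {z. ?B z = 0}"
    unfolding bilinear_relators_def by (auto simp: B.diff B.scale B_gen b)
  then have ker: "ext z = 0 \<Longrightarrow> ?B z = 0" for z
    using kernel free.span_minimal[OF _ B.subspace_kernel] by blast
  define pre where "pre t = (SOME z. ext z = t)" for t
  have pre: "ext (pre t) = t" for t
    unfolding pre_def using onto by (metis (mono_tags, lifting) someI_ex surjD)
  have well: "?B (pre (ext z)) = ?B z" for z
    using ker[of "pre (ext z) - z"] by (simp add: ext.diff B.diff pre)
  have "Vector_Spaces.linear sT sU (\<lambda>t. ?B (pre t))"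
    unfolding Vector_Spaces.linear_iff
  proof (intro conjI allI T.vector_space_axioms U)
    fix s t c
    show "?B (pre (s + t)) = ?B (pre s) + ?B (pre t)"
      using well[of "pre s + pre t"] by (simp add: ext.add B.add pre)
    show "?B (pre (sT c t)) = sU c (?B (pre t))"
      using well[of "free_scale c (pre t)"] by (simp add: ext.scale B.scale pre)
  qed
  moreover have "?B (pre (tens x w)) = b x w" for x w
    using well[of "free_gen (x, w)"] by (simp only: ext_gen B_gen)
  ultimately show "\<exists>h. Vector_Spaces.linear sT sU h \<and> (\<forall>x w. h (tens x w) = b x w)" by blast
next
  fix h h'
  assume "Vector_Spaces.linear sT sU h \<and> (\<forall>x w. h (tens x w) = b x w)"
    "Vector_Spaces.linear sT sU h' \<and> (\<forall>x w. h' (tens x w) = b x w)"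
  then show "h = h'" by (intro linear_tens_ext) auto
qed

lemma tensor_map:
  assumes A: "Vector_Spaces.linear sE sE A" and B: "Vector_Spaces.linear sF sF B"
  shows "Vector_Spaces.linear sT sT (tensor_map sT tens A B)"
    and "tensor_map sT tens A B (tens x w) = tens (A x) (B w)"
proof -
  interpret A: Vector_Spaces.linear sE sE A by fact
  interpret B: Vector_Spaces.linear sF sF B by fact
  have "\<exists>!h. Vector_Spaces.linear sT sT h \<and> (\<forall>x w. h (tens x w) = tens (A x) (B w))"
    by (rule bilinear_extend_ex1)
      (simp_all add: T.vector_space_axioms A.add B.add A.scale B.scale tens_bilinear)
  from theI'[OF this] show "Vector_Spaces.linear sT sT (tensor_map sT tens A B)"
    and "tensor_map sT tens A B (tens x w) = tens (A x) (B w)"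
    unfolding tensor_map_def by auto
qed

end

text \<open>
  For every vector space \<open>E\<close>, the families of elements of \<open>E\<close> indexed by the monomials are a tensor
  product of \<open>E\<close> with the Grassmann algebra.
\<close>

lemma tensor_product_grassmann:
  fixes sE :: "'f::field \<Rightarrow> 'e::ab_group_add \<Rightarrow> 'e"
  assumes "vector_space sE"
  defines "tens \<equiv> \<lambda>x (w :: ('f, 'n::{finite, linorder}) grassmann) I. sE (coeff w I) x"
  shows "tensor_product sE gscale (\<lambda>c (u :: 'n set \<Rightarrow> 'e) I. sE c (u I)) tens"
proof -
  let ?sT = "\<lambda>c (u :: 'n set \<Rightarrow> 'e) I. sE c (u I)"
  let ?ext = "free_extend ?sT (\<lambda>(x, w). tens x w)"
  let ?R = "module.span free_scale (bilinear_relators sE gscale)"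
  interpret E: vector_space sE by fact
  interpret G: vector_space "gscale :: 'f \<Rightarrow> ('f, 'n) grassmann \<Rightarrow> _" by (rule vector_space_gscale)
  interpret free: vector_space "free_scale :: 'f \<Rightarrow> ('e \<times> ('f, 'n) grassmann \<Rightarrow>\<^sub>0 'f) \<Rightarrow> _"
    by (rule vector_space_free_scale)
  have T: "vector_space ?sT"
    by unfold_locales (auto simp: fun_eq_iff E.scale_right_distrib E.scale_left_distrib)
  interpret T: vector_space ?sT by (rule T)
  interpret ext: Vector_Spaces.linear free_scale ?sT ?ext
    by (rule linear_free_extend) (rule T)
  have gen: "?ext (free_gen (x, w)) = tens x w" for x w
    by (simp add: T)
  define std where "std u = (\<Sum>I\<in>UNIV. free_gen (u I, monomial I :: ('f, 'n) grassmann) ::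
      'e \<times> ('f, 'n) grassmann \<Rightarrow>\<^sub>0 'f)" for u
  have add1: "free_gen (x + y, w) - (free_gen (x, w) + free_gen (y, w)) \<in> ?R"
    for x y and w :: "('f, 'n) grassmann"
    unfolding diff_diff_eq[symmetric]
    by (rule free.span_base) (unfold bilinear_relators_def, blast)
  have add2: "free_gen (x, v + w) - (free_gen (x, v) + free_gen (x, w)) \<in> ?R"
    for x and v w :: "('f, 'n) grassmann"
    unfolding diff_diff_eq[symmetric]
    by (rule free.span_base) (unfold bilinear_relators_def, blast)
  have sc1: "free_gen (sE c x, w) - free_scale c (free_gen (x, w)) \<in> ?R"
    for c x and w :: "('f, 'n) grassmann"
    by (rule free.span_base) (unfold bilinear_relators_def, blast)
  have sc2: "free_gen (x, gscale c w) - free_scale c (free_gen (x, w)) \<in> ?R"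
    for c x and w :: "('f, 'n) grassmann"
    by (rule free.span_base) (unfold bilinear_relators_def, blast)
  have zero: "free_gen (0, w) \<in> ?R" for w :: "('f, 'n) grassmann"
    using sc1[of 0 0 w] by simp
  have zero2: "free_gen (x, 0 :: ('f, 'n) grassmann) \<in> ?R" for x
    using sc2[of x 0 0] by simp
  have std0: "std (\<lambda>I. 0) \<in> ?R"
    unfolding std_def by (intro free.span_sum zero)
  have std_add: "std (u + v) - (std u + std v) \<in> ?R" for u v
    unfolding std_def plus_fun_def sum.distrib[symmetric] sum_subtractf[symmetric]
    by (intro free.span_sum add1)
  have std_scale: "std (?sT c u) - free_scale c (std u) \<in> ?R" for c u
    unfolding std_def free.scale_sum_right sum_subtractf[symmetric]
    by (intro free.span_sum sc1)
  have std_gen: "free_gen (x, w) - std (tens x w) \<in> ?R" for x w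
  proof -
    have sumI: "free_gen (x, sum f S) - (\<Sum>I\<in>S. free_gen (x, f I)) \<in> ?R" if "finite S"
      for f :: "'n set \<Rightarrow> ('f, 'n) grassmann" and S
      using that
    proof (induction S rule: finite_induct)
      case (insert I S)
      from free.span_add[OF add2[of x "f I" "sum f S"] insert.IH] insert.hyps
      show ?case by (simp add: algebra_simps)
    qed (simp add: zero2)
    have "free_gen (x, gscale (coeff w I) (monomial I)) - free_gen (sE (coeff w I) x, monomial I) \<in> ?R" for I
      using free.span_diff[OF sc2[of x "coeff w I" "monomial I"] sc1[of "coeff w I" x "monomial I"]]
      by (simp add: algebra_simps)
    then have "(\<Sum>I\<in>UNIV. free_gen (x, gscale (coeff w I) (monomial I)) -
        free_gen (sE (coeff w I) x, monomial I)) \<in> ?R"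
      by (intro free.span_sum)
    with sumI[of UNIV "\<lambda>I. gscale (coeff w I) (monomial I)"] show ?thesis
      unfolding std_def tens_def sum_subtractf grassmann_expand[of w, symmetric]
      using free.span_add by fastforce
  qed
  have std: "z - std (?ext z) \<in> ?R" for z
  proof -
    have "free.subspace {z. z - std (?ext z) \<in> ?R}"
    proof (rule free.subspaceI; clarsimp)
      show "- std 0 \<in> ?R"
        using free.span_neg[OF std0] by (simp add: zero_fun_def)
      fix y z assume y: "y - std (?ext y) \<in> ?R" and z: "z - std (?ext z) \<in> ?R"
      from free.span_diff[OF free.span_add[OF y z] std_add[of "?ext y" "?ext z"]]
      show "y + z - std (?ext (y + z)) \<in> ?R"
        by (simp add: ext.add algebra_simps)
    next
      fix c z assume z: "z - std (?ext z) \<in> ?R"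
      from free.span_diff[OF free.span_scale[OF z, of c] std_scale[of c "?ext z"]]
      show "free_scale c z - std (?ext (free_scale c z)) \<in> ?R"
        by (simp add: ext.scale free.scale_right_diff_distrib)
    qed
    moreover have "free_gen p \<in> {z. z - std (?ext z) \<in> ?R}" for p
      by (cases p) (simp only: mem_Collect_eq gen std_gen)
    ultimately have "(\<Sum>p\<in>Poly_Mapping.keys z. free_scale (Poly_Mapping.lookup z p) (free_gen p)) \<in>
        {z. z - std (?ext z) \<in> ?R}"
      by (intro free.subspace_sum free.subspace_scale)
    then show ?thesis
      using free_expand[of z] by simp
  qed
  show ?thesis
  proof
    show "surj ?ext"
    proof (rule surjI)
      fix u
      have "?ext (std u) = (\<Sum>I\<in>UNIV. tens (u I) (monomial I))"
        unfolding std_def by (simp add: ext.sum gen del: free_extend_gen)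
      also have "\<dots> = u"
      proof
        fix J
        have *: "(\<Sum>I\<in>S. tens (u I) (monomial I)) J = (\<Sum>I\<in>S. if I = J then u J else 0)" for S
          by (induction S rule: infinite_finite_induct) (auto simp: tens_def)
        show "(\<Sum>I\<in>UNIV. tens (u I) (monomial I)) J = u J"
          unfolding * by simp
      qed
      finally show "?ext (std u) = u" .
    qed
    show "{z. ?ext z = 0} = ?R"
    proof
      show "{z. ?ext z = 0} \<subseteq> ?R"
      proof clarify
        fix z assume "?ext z = 0"
        with std[of z] std0 show "z \<in> ?R"
          using free.span_add by (fastforce simp: zero_fun_def)
      qed
      have "tens (x + y) w = tens x w + tens y w" "tens x (v + w) = tens x v + tens x w"
        "tens (sE c x) w = ?sT c (tens x w)" "tens x (gscale c w) = ?sT c (tens x w)" for x y v w c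
        by (auto simp: tens_def fun_eq_iff E.scale_right_distrib E.scale_left_distrib mult.commute)
      then have "bilinear_relators sE gscale \<subseteq> {z. ?ext z = 0}"
        unfolding bilinear_relators_def
        by (auto simp: ext.diff ext.scale gen simp del: free_extend_gen)
      then show "?R \<subseteq> {z. ?ext z = 0}"
        by (rule free.span_minimal) (rule ext.subspace_kernel)
    qed
  qed
qed


section \<open>The Koszul operators\<close>

definition commutator :: "('e::ab_group_add \<Rightarrow> 'e) \<Rightarrow> ('e \<Rightarrow> 'e) \<Rightarrow> 'e \<Rightarrow> 'e" where
  "commutator A B = (\<lambda>x. A (B x) - B (A x))"

definition koszul_cohomology :: "('f::field \<Rightarrow> 't::ab_group_add \<Rightarrow> 't) \<Rightarrow>
    ('e::ab_group_add \<Rightarrow> ('f, 'n::{finite, linorder}) grassmann \<Rightarrow> 't) \<Rightarrow> ('n \<Rightarrow> 'e \<Rightarrow> 'e) \<Rightarrow> 't \<Rightarrow> 't" where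
  "koszul_cohomology sT tens X = (\<lambda>t. \<Sum>l\<in>UNIV. tensor_map sT tens (X l) (ext_mult l) t)"

definition koszul_homology :: "('f::field \<Rightarrow> 't::ab_group_add \<Rightarrow> 't) \<Rightarrow>
    ('e::ab_group_add \<Rightarrow> ('f, 'n::{finite, linorder}) grassmann \<Rightarrow> 't) \<Rightarrow> ('n \<Rightarrow> 'e \<Rightarrow> 'e) \<Rightarrow> 't \<Rightarrow> 't" where
  "koszul_homology sT tens Y = (\<lambda>t. \<Sum>k\<in>UNIV. tensor_map sT tens (Y k) (int_mult k) t)"

end

theory Submission
  imports Defs
begin

text \<open>
  Both sides are linear, so it suffices to compare them on pure tensors \<open>x \<otimes> w\<close>. There the claim
  follows from the relation \<open>i\<^sub>k e\<^sub>l + e\<^sub>l i\<^sub>k = \<delta>\<^sub>k\<^sub>l\<close>, an instance of the Leibniz rule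
  of \<open>i\<^sub>k\<close>; the terms with \<open>k = l\<close> contribute \<open>Y\<^sub>l X\<^sub>l \<otimes> id\<close>.
\<close>

text \<open>The definite description behind \<open>int_mult\<close> is replaced by the explicit
  \<open>contraction\<close>, for which the Leibniz rule has been verified on coefficients.\<close>

lemma antiderivation_int_mult: "antiderivation (int_mult k)"
  by (simp add: int_mult_eq_contraction antiderivation_contraction)

lemma linear_int_mult: "Vector_Spaces.linear gscale gscale (int_mult k)"
  using antiderivation_int_mult by (auto simp: antiderivation_def)

lemma linear_ext_mult: "Vector_Spaces.linear gscale gscale (ext_mult l)"
  unfolding Vector_Spaces.linear_iff
  by (auto simp: vector_space_gscale ext_mult_def gscale_mult algebra_simps)

text \<open>The generator \<open>\<eta> l\<close> has degree 1, so the Leibniz rule picks up the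
  sign -1, and its first term is the scalar \<open>int_mult k (\<eta> l)\<close>, which is 1 or 0,
  times \<open>w\<close>.\<close>

lemma int_mult_ext_mult:
  "int_mult k (ext_mult l w) = (if k = l then w else 0) - ext_mult l (int_mult k w)"
proof -
  have "homogeneous 1 (\<eta> l)"
    using homogeneous_monomial[of "{l}"] by (simp add: gen_def)
  then have "int_mult k (\<eta> l * w) = int_mult k (\<eta> l) * w + (-1) ^ 1 * (\<eta> l * int_mult k w)"
    using antiderivation_int_mult[of k] unfolding antiderivation_def by blast
  then show ?thesis
    by (simp add: ext_mult_def int_mult_eq_contraction contraction_gen)
qed

context tensor_product
begin

text \<open>Recasting bilinearity as \<open>additive\<close> in each slot makes the rules for
  differences, zero and finite sums available.\<close>

lemma tens_additive_left: "additive (\<lambda>x. tens x w)"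
  by (rule additive.intro) (rule tens_bilinear)

lemma tens_additive_right: "additive (tens x)"
  by (rule additive.intro) (rule tens_bilinear)

text \<open>Both Koszul operators are sums of this shape, so this one fact yields their
  linearity.\<close>

lemma linear_sum_tensor_map:
  assumes "\<And>i. i \<in> S \<Longrightarrow> Vector_Spaces.linear sE sE (A i)"
    and "\<And>i. i \<in> S \<Longrightarrow> Vector_Spaces.linear sF sF (B i)"
  shows "Vector_Spaces.linear sT sT (\<lambda>t. \<Sum>i\<in>S. tensor_map sT tens (A i) (B i) t)"
proof -
  interpret TT: vector_space_pair sT sT ..
  show ?thesis
    using assms by (auto intro!: TT.linear_compose_sum tensor_map(1))
qed

end

theorem proposition8:
  fixes sE :: "'f::field_char_0 \<Rightarrow> 'e::ab_group_add \<Rightarrow> 'e"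
    and sT :: "'f \<Rightarrow> 't::ab_group_add \<Rightarrow> 't"
    and tens :: "'e \<Rightarrow> ('f, 'n::{finite, linorder}) grassmann \<Rightarrow> 't"
    and X Y :: "'n \<Rightarrow> 'e \<Rightarrow> 'e"
  assumes "vector_space sE"
    and "tensor_product sE gscale sT tens"
    and "\<And>l. Vector_Spaces.linear sE sE (X l)"
    and "\<And>k. Vector_Spaces.linear sE sE (Y k)"
    and "\<And>k l. X k \<circ> X l = X l \<circ> X k"
    and "\<And>k l. Y k \<circ> Y l = Y l \<circ> Y k"
  defines "K \<equiv> koszul_cohomology sT tens X"
    and "\<kappa> \<equiv> koszul_homology sT tens Y"
  shows "(\<lambda>t. K (\<kappa> t) + \<kappa> (K t)) =
    (\<lambda>t. tensor_map sT tens (\<lambda>x. \<Sum>l\<in>UNIV. Y l (X l x)) id t +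
      (\<Sum>k\<in>UNIV. \<Sum>l\<in>UNIV.
        tensor_map sT tens (commutator (X l) (Y k)) (ext_mult l \<circ> int_mult k) t))"
proof -
  interpret tensor_product sE gscale sT tens by fact
  interpret EE: vector_space_pair sE sE ..
  interpret TT: vector_space_pair sT sT ..
  note X = assms(3) and Y = assms(4)
  \<comment> \<open>\<open>tensor_map\<close> is a definite description whose rules require linear
    factors, so linearity is first established for every factor on the right-hand side.\<close>
  have YX: "Vector_Spaces.linear sE sE (\<lambda>x. Y k (X l x))" for k l
    using Vector_Spaces.linear_compose[OF X Y] by (simp add: o_def)
  have XY: "Vector_Spaces.linear sE sE (\<lambda>x. X l (Y k x))" for k l
    using Vector_Spaces.linear_compose[OF Y X] by (simp add: o_def)
  have sum_YX: "Vector_Spaces.linear sE sE (\<lambda>x. \<Sum>l\<in>UNIV. Y l (X l x))"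
    by (intro EE.linear_compose_sum ballI YX)
  have comm: "Vector_Spaces.linear sE sE (commutator (X l) (Y k))" for k l
    unfolding commutator_def by (intro EE.linear_compose_sub XY YX)
  have ei: "Vector_Spaces.linear gscale gscale (ext_mult l \<circ> int_mult k)" for k l :: 'n
    by (rule Vector_Spaces.linear_compose[OF linear_int_mult linear_ext_mult])
  have id: "Vector_Spaces.linear gscale gscale (id :: ('f, 'n) grassmann \<Rightarrow> _)"
    by (rule F.linear_id)
  have K: "Vector_Spaces.linear sT sT K"
    unfolding K_def koszul_cohomology_def
    by (intro linear_sum_tensor_map X linear_ext_mult)
  have \<kappa>: "Vector_Spaces.linear sT sT \<kappa>"
    unfolding \<kappa>_def koszul_homology_def
    by (intro linear_sum_tensor_map Y linear_int_mult)
  interpret K: Vector_Spaces.linear sT sT K by (rule K)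
  interpret \<kappa>: Vector_Spaces.linear sT sT \<kappa> by (rule \<kappa>)
  have K_tens: "K (tens x w) = (\<Sum>l\<in>UNIV. tens (X l x) (ext_mult l w))" for x w
    by (simp add: K_def koszul_cohomology_def tensor_map(2) X linear_ext_mult)
  have \<kappa>_tens: "\<kappa> (tens x w) = (\<Sum>k\<in>UNIV. tens (Y k x) (int_mult k w))" for x w
    by (simp add: \<kappa>_def koszul_homology_def tensor_map(2) Y linear_int_mult)
  show ?thesis
  proof (rule linear_tens_ext)
    show "Vector_Spaces.linear sT sT (\<lambda>t. K (\<kappa> t) + \<kappa> (K t))"
      using Vector_Spaces.linear_compose[OF \<kappa> K] Vector_Spaces.linear_compose[OF K \<kappa>]
      by (intro TT.linear_compose_add) (simp_all add: o_def)
    show "Vector_Spaces.linear sT sT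
      (\<lambda>t. tensor_map sT tens (\<lambda>x. \<Sum>l\<in>UNIV. Y l (X l x)) id t +
        (\<Sum>k\<in>UNIV. \<Sum>l\<in>UNIV.
          tensor_map sT tens (commutator (X l) (Y k)) (ext_mult l \<circ> int_mult k) t))"
      by (intro TT.linear_compose_add TT.linear_compose_sum ballI tensor_map(1)
          sum_YX id comm ei)
    fix x w
    \<comment> \<open>The anticommutation relation is applied in the second slot; the case
      distinction moves out of \<open>tens\<close> because a tensor with 0 vanishes.\<close>
    have swap: "tens (Y k (X l x)) (int_mult k (ext_mult l w)) =
        (if k = l then tens (Y l (X l x)) w else 0) -
        tens (Y k (X l x)) (ext_mult l (int_mult k w))" for k l
      by (simp add: int_mult_ext_mult additive.diff[OF tens_additive_right]
          additive.zero[OF tens_additive_right])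
    have "tens (commutator (X l) (Y k) x) v = tens (X l (Y k x)) v - tens (Y k (X l x)) v" for k l v
      by (simp add: commutator_def additive.diff[OF tens_additive_left])
    moreover have "K (\<kappa> (tens x w)) =
        (\<Sum>k\<in>UNIV. \<Sum>l\<in>UNIV. tens (X l (Y k x)) (ext_mult l (int_mult k w)))"
      by (simp add: \<kappa>_tens K_tens K.sum)
    \<comment> \<open>Expansion puts \<open>l\<close> outside; the sums are interchanged to match
      the order in \<open>K (\<kappa> (tens x w))\<close>.\<close>
    moreover have "\<kappa> (K (tens x w)) =
        (\<Sum>k\<in>UNIV. \<Sum>l\<in>UNIV. tens (Y k (X l x)) (int_mult k (ext_mult l w)))"
      by (simp add: \<kappa>_tens K_tens \<kappa>.sum) (rule sum.swap)
    \<comment> \<open>The Kronecker delta collapses the inner sum to its diagonal term.\<close>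
    moreover have "\<dots> = (\<Sum>l\<in>UNIV. tens (Y l (X l x)) w) -
        (\<Sum>k\<in>UNIV. \<Sum>l\<in>UNIV. tens (Y k (X l x)) (ext_mult l (int_mult k w)))"
      by (simp add: swap sum_subtractf)
    \<comment> \<open>The two remaining double sums share the second factor
      \<open>ext_mult l (int_mult k w)\<close> and have opposite signs, so their first factors
      combine into the commutators.\<close>
    ultimately show "K (\<kappa> (tens x w)) + \<kappa> (K (tens x w)) =
      tensor_map sT tens (\<lambda>x. \<Sum>l\<in>UNIV. Y l (X l x)) id (tens x w) +
        (\<Sum>k\<in>UNIV. \<Sum>l\<in>UNIV.
          tensor_map sT tens (commutator (X l) (Y k)) (ext_mult l \<circ> int_mult k) (tens x w))"
      by (simp add: tensor_map(2) sum_YX id comm ei sum_subtractf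
          additive.sum[OF tens_additive_left])
  qed
qed

end
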